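(* Let $k\in\{0,1,\dots,n\}$ and let $E\subset\mathbb{R}^n$ be a set with the following property: for every $\delta>0$ there exists $\rho_0=\rho_0(n,\delta)>0$ such that for every $\rho\in(0,\rho_0)$ and every $y\in E$ there exists a $k$-plane $L=L(y,\rho)\subset\mathbb{R}^n$ with $$\eta_{y,\rho}\big(E\cap\mathbf{B}_\rho(y)\big)\subset L+\mathbf{B}_\delta(0).$$ Then there exists a modulus of continuity $\omega$ such that $\mathcal{H}^{k+\omega(\delta)}(E)=0$ for every $\delta>0$.
   Context: $\eta_{y,\rho}(x)=\frac{x-y}{\rho}$. A $k$-plane is a $k$-dimensional linear subspace of $\mathbb{R}^n$. $L+\mathbf{B}_\delta(0)$ is the $\delta$-neighbourhood of $L$. $\mathcal{H}^s$ is the $s$-dimensional Hausdorff measure on $\mathbb{R}^n$. A modulus of continuity is a non-decreasing function $\omega:(0,\infty)\to(0,\infty)$ with $\lim_{s\to0^+}\omega(s)=0$. *)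

theory Defs
  imports "HOL-Analysis.Analysis" "HOL-Library.Set_Algebras"
begin

definition blowup :: "'a::real_normed_vector \<Rightarrow> real \<Rightarrow> 'a \<Rightarrow> 'a" where
  "blowup y \<rho> x = (x - y) /\<^sub>R \<rho>"

definition plane :: "nat \<Rightarrow> 'a::euclidean_space set \<Rightarrow> bool" where
  "plane k L \<longleftrightarrow> subspace L \<and> dim L = k"

text \<open>The weight of a set in the definition of the \<open>s\<close>-dimensional Hausdorff measure,
  with the usual normalisation \<open>\<alpha>(s) (diam C / 2)^s\<close>,
  \<open>\<alpha>(s) = \<pi>^(s/2) / \<Gamma>(s/2 + 1)\<close>. The case \<open>s = 0\<close> is separate because
  \<open>0 powr 0 = 0\<close> in the library, whereas a nonempty set must have weight 1
  (so that the 0-dimensional measure is counting measure).\<close>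

definition hausdorff_weight :: "real \<Rightarrow> 'a::metric_space set \<Rightarrow> ennreal" where
  "hausdorff_weight s C =
    (if C = {} then 0
     else if s = 0 then 1
     else ennreal (unit_ball_vol s * (diameter C / 2) powr s))"

text \<open>Boundedness of the covering sets is explicit because the library gives
  unbounded sets \<open>diameter\<close> 0. Finite covers are included, since the \<open>C i\<close> may be empty.\<close>

definition hausdorff_premeasure :: "real \<Rightarrow> real \<Rightarrow> 'a::metric_space set \<Rightarrow> ennreal" where
  "hausdorff_premeasure \<delta> s A =
    (INF C \<in> {C :: nat \<Rightarrow> 'a set.
        A \<subseteq> (\<Union>i. C i) \<and> (\<forall>i. bounded (C i) \<and> diameter (C i) \<le> \<delta>)}.
      (\<Sum>i. hausdorff_weight s (C i)))"

definition hausdorff_measure :: "real \<Rightarrow> 'a::metric_space set \<Rightarrow> ennreal" where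
  "hausdorff_measure s A = (SUP \<delta> \<in> {0<..}. hausdorff_premeasure \<delta> s A)"

text \<open>A modulus of continuity is a function on \<open>(0,\<infinity>)\<close>; its values at nonpositive
  arguments are irrelevant.\<close>

definition modulus_of_continuity :: "(real \<Rightarrow> real) \<Rightarrow> bool" where
  "modulus_of_continuity \<omega> \<longleftrightarrow>
    (\<forall>s>0. \<omega> s > 0) \<and> mono_on {0<..} \<omega> \<and> (\<omega> \<longlongrightarrow> 0) (at_right 0)"

end

theory Submission imports Defs begin

text \<open>
  The identity is a modulus of continuity, so the theorem says precisely that the Hausdorff
  dimension of \<open>E\<close> is at most \<open>k\<close>: it suffices to show that the \<open>t\<close>-dimensional measure of
  \<open>E\<close> vanishes for every \<open>t > k\<close>.

  The flatness hypothesis is used at a single small \<open>\<epsilon>\<close>. A bounded part of a \<open>k\<close>-plane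
  is covered by a constant times \<open>\<epsilon>\<^sup>-\<^sup>k\<close> balls of radius \<open>\<epsilon>\<close>, where the constant depends only
  on \<open>k\<close> (\<open>subspace_ball_grid_net\<close>). Hence \<open>E \<inter> ball y \<rho>\<close> is covered by a constant times
  \<open>\<epsilon>\<^sup>-\<^sup>k\<close> balls of radius \<open>4\<epsilon>\<rho>\<close> which are again centred on \<open>E\<close>
  (\<open>flat_at_scale_imp_cover\<close>), so that the hypothesis applies to each of them.
  One such step multiplies the sum of the \<open>t\<close>-th powers of the radii by at most a constant times
  \<open>\<epsilon> powr (t - k)\<close>. Since \<open>t > k\<close>, this factor is below \<open>1\<close> once \<open>\<epsilon>\<close> is small, and iterating
  the step at this fixed \<open>\<epsilon>\<close> drives the sum to zero (\<open>self_similar_cover_imp_null\<close>).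
  Countably many of the balls cover \<open>E\<close>.
\<close>

section \<open>Sets of Hausdorff measure zero\<close>

lemma hausdorff_premeasure_le_cover:
  assumes "A \<subseteq> (\<Union>i. C i)" "\<And>i. bounded (C i)" "\<And>i. diameter (C i) \<le> d"
  shows "hausdorff_premeasure d s A \<le> (\<Sum>i. hausdorff_weight s (C i))"
  unfolding hausdorff_premeasure_def by (rule INF_lower) (use assms in auto)

lemma hausdorff_measure_eq_0_iff:
  "hausdorff_measure s A = 0 \<longleftrightarrow> (\<forall>d>0. hausdorff_premeasure d s A = 0)"
proof -
  have "hausdorff_measure s A = 0 \<longleftrightarrow> hausdorff_measure s A \<le> 0"
    by simp
  also have "\<dots> \<longleftrightarrow> (\<forall>d>0. hausdorff_premeasure d s A = 0)"
    unfolding hausdorff_measure_def SUP_le_iff by auto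
  finally show ?thesis .
qed

text \<open>The usual argument for countable subadditivity: cover the \<open>j\<close>-th set with total weight
  at most \<open>e / 2\<^sup>j\<^sup>+\<^sup>1\<close> and enumerate all the covering sets in one sequence.\<close>

lemma hausdorff_premeasure_UN_eq_0:
  fixes A :: "nat \<Rightarrow> 'a::metric_space set"
  assumes "\<And>j. hausdorff_premeasure d s (A j) = 0"
  shows "hausdorff_premeasure d s (\<Union>j. A j) = 0"
proof -
  have le: "hausdorff_premeasure d s (\<Union>j. A j) \<le> 0 + ennreal e" if "e > 0" for e :: real
  proof -
    have "\<exists>C. (A j \<subseteq> (\<Union>i. C i) \<and> (\<forall>i. bounded (C i) \<and> diameter (C i) \<le> d)) \<and>
        (\<Sum>i. hausdorff_weight s (C i)) < ennreal (e * (1/2) ^ Suc j)" for j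
    proof -
      have "hausdorff_premeasure d s (A j) < ennreal (e * (1/2) ^ Suc j)"
        using assms[of j] \<open>e > 0\<close> by (simp add: ennreal_zero_less_divide)
      then show ?thesis
        unfolding hausdorff_premeasure_def INF_less_iff by auto
    qed
    then obtain C where C: "\<And>j. A j \<subseteq> (\<Union>i. C j i)"
      "\<And>j i. bounded (C j i)" "\<And>j i. diameter (C j i) \<le> d"
      "\<And>j. (\<Sum>i. hausdorff_weight s (C j i)) < ennreal (e * (1/2) ^ Suc j)"
      by metis
    define D where "D = (\<lambda>(j, i). C j i) \<circ> prod_decode"
    have "(\<Union>j. A j) \<subseteq> (\<Union>m. D m)"
    proof
      fix x assume "x \<in> (\<Union>j. A j)"
      then obtain j i where "x \<in> C j i"
        using C(1) by blast
      then have "x \<in> D (prod_encode (j, i))"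
        by (simp add: D_def)
      then show "x \<in> (\<Union>m. D m)" by blast
    qed
    then have "hausdorff_premeasure d s (\<Union>j. A j) \<le> (\<Sum>m. hausdorff_weight s (D m))"
      by (rule hausdorff_premeasure_le_cover) (use C(2,3) in \<open>auto simp: D_def case_prod_beta\<close>)
    also have "\<dots> = (\<Sum>j. \<Sum>i. hausdorff_weight s (C j i))"
      using suminf_ennreal_2dimen[of "\<lambda>j. \<Sum>i. hausdorff_weight s (C j i)"
          "\<lambda>(j, i). hausdorff_weight s (C j i)"]
      by (simp add: D_def case_prod_beta)
    also have "\<dots> \<le> (\<Sum>j. ennreal (e * (1/2) ^ Suc j))"
      by (intro suminf_le) (use C(4) in \<open>auto intro: less_imp_le\<close>)
    also have "\<dots> = ennreal e"
    proof (rule suminf_ennreal_eq)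
      show "(\<lambda>j. e * (1/2) ^ Suc j) sums e"
        using sums_mult[OF power_half_series, of e] by simp
    qed (use \<open>e > 0\<close> in auto)
    finally show ?thesis by simp
  qed
  have "hausdorff_premeasure d s (\<Union>j. A j) \<le> 0"
    by (rule ennreal_le_epsilon) (rule le)
  then show ?thesis by simp
qed

lemma hausdorff_measure_UN_eq_0:
  fixes A :: "'i \<Rightarrow> 'a::metric_space set"
  assumes "countable I" "I \<noteq> {}" "\<And>i. i \<in> I \<Longrightarrow> hausdorff_measure s (A i) = 0"
  shows "hausdorff_measure s (\<Union>i\<in>I. A i) = 0"
proof -
  have "(\<Union>i\<in>I. A i) = (\<Union>j. A (from_nat_into I j))"
    using range_from_nat_into[OF assms(2,1)] by (metis image_image)
  then show ?thesis
    using assms by (simp add: hausdorff_measure_eq_0_iff hausdorff_premeasure_UN_eq_0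
        from_nat_into)
qed

lemma hausdorff_measure_subset_eq_0:
  assumes "A \<subseteq> B" "hausdorff_measure s B = 0"
  shows "hausdorff_measure s A = 0"
proof -
  have "hausdorff_premeasure d s A \<le> hausdorff_premeasure d s B" for d
    unfolding hausdorff_premeasure_def using assms(1)
    by (intro INF_superset_mono Collect_mono impI conjI order_refl) auto
  then show ?thesis
    using assms(2) unfolding hausdorff_measure_eq_0_iff by (metis le_zero_eq)
qed

lemma hausdorff_measure_empty: "hausdorff_measure s ({} :: 'a::metric_space set) = 0"
proof -
  have "hausdorff_premeasure d s ({} :: 'a set) = 0" if "d > 0" for d
    using hausdorff_premeasure_le_cover[of "{}" "\<lambda>_. {} :: 'a set" d s] that
    by (simp add: hausdorff_weight_def)
  then show ?thesis by (simp add: hausdorff_measure_eq_0_iff)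
qed

section \<open>Iterated covers by balls\<close>

lemma diameter_ball_le:
  fixes z :: "'a::metric_space"
  assumes "r \<ge> 0"
  shows "diameter (ball z r) \<le> 2 * r"
proof (cases "ball z r = {}")
  case False
  have "dist x y \<le> 2 * r" if "x \<in> ball z r" "y \<in> ball z r" for x y
    using that dist_triangle3[of x y z] by simp
  then show ?thesis
    using False by (auto simp: diameter_def intro!: cSUP_least)
qed (use assms in simp)

lemma hausdorff_weight_ball_le:
  fixes z :: "'a::metric_space"
  assumes "t > 0" "r \<ge> 0"
  shows "hausdorff_weight t (ball z r) \<le> ennreal (unit_ball_vol t * r powr t)"
proof -
  have "diameter (ball z r) \<ge> 0"
    by (rule diameter_ge_0) simp
  then have "(diameter (ball z r) / 2) powr t \<le> r powr t"
    using diameter_ball_le[OF assms(2), of z] assms by (intro powr_mono2) auto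
  then show ?thesis
    using assms unfolding hausdorff_weight_def
    by (auto intro!: ennreal_leI mult_left_mono unit_ball_vol_nonneg)
qed

lemma hausdorff_premeasure_le_card:
  fixes A :: "'a::metric_space set"
  assumes "t > 0" "r \<ge> 0" "2 * r \<le> d" "finite Z" "A \<subseteq> (\<Union>z\<in>Z. ball z r)"
  shows "hausdorff_premeasure d t A \<le> ennreal (card Z * (unit_ball_vol t * r powr t))"
proof -
  obtain f where f: "f ` {..<card Z} = Z"
    using \<open>finite Z\<close> ex_bij_betw_nat_finite[of Z] unfolding bij_betw_def
    by (auto simp: lessThan_atLeast0)
  define C where "C i = (if i < card Z then ball (f i) r else {})" for i
  have "A \<subseteq> (\<Union>i. C i)"
  proof
    fix x assume "x \<in> A"
    then obtain z where "z \<in> Z" "x \<in> ball z r"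
      using assms(5) by blast
    moreover from \<open>z \<in> Z\<close> obtain i where "i < card Z" "z = f i"
      using f by (metis imageE lessThan_iff)
    ultimately show "x \<in> (\<Union>i. C i)"
      unfolding C_def by (intro UN_I[of i]) auto
  qed
  then have "hausdorff_premeasure d t A \<le> (\<Sum>i. hausdorff_weight t (C i))"
    using order_trans[OF diameter_ball_le[OF assms(2)] assms(3)] assms(2,3)
    by (intro hausdorff_premeasure_le_cover) (auto simp: C_def)
  also have "\<dots> = (\<Sum>i<card Z. hausdorff_weight t (C i))"
    by (rule suminf_finite) (auto simp: C_def hausdorff_weight_def)
  also have "\<dots> \<le> (\<Sum>i<card Z. ennreal (unit_ball_vol t * r powr t))"
    using hausdorff_weight_ball_le[OF assms(1,2)] by (intro sum_mono) (simp add: C_def)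
  also have "\<dots> = ennreal (card Z * (unit_ball_vol t * r powr t))"
    using assms(1) by (simp add: ennreal_mult unit_ball_vol_nonneg ennreal_of_nat_eq_real_of_nat)
  finally show ?thesis .
qed

text \<open>The new balls are centred on \<open>E\<close> and are smaller than the old ones, so the hypothesis can
  be applied to them again.\<close>

lemma iterate_ball_cover:
  fixes E :: "'a::metric_space set" and N \<tau> \<rho>\<^sub>0 :: real
  assumes "0 < \<tau>" "\<tau> < 1"
    and cover: "\<And>y \<rho>. y \<in> E \<Longrightarrow> 0 < \<rho> \<Longrightarrow> \<rho> < \<rho>\<^sub>0 \<Longrightarrow>
      \<exists>Z\<subseteq>E. finite Z \<and> card Z \<le> N \<and> E \<inter> ball y \<rho> \<subseteq> (\<Union>z\<in>Z. ball z (\<tau> * \<rho>))"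
    and "y \<in> E" "0 < \<rho>" "\<rho> < \<rho>\<^sub>0"
  shows "\<exists>Z\<subseteq>E. finite Z \<and> card Z \<le> N ^ m \<and> E \<inter> ball y \<rho> \<subseteq> (\<Union>z\<in>Z. ball z (\<tau> ^ m * \<rho>))"
proof (induction m)
  case 0
  show ?case using \<open>y \<in> E\<close> by (intro exI[of _ "{y}"]) auto
next
  case (Suc m)
  then obtain Z where Z: "Z \<subseteq> E" "finite Z" "card Z \<le> N ^ m"
    "E \<inter> ball y \<rho> \<subseteq> (\<Union>z\<in>Z. ball z (\<tau> ^ m * \<rho>))" by blast
  have "\<tau> ^ m * \<rho> \<le> 1 * \<rho>"
    using assms by (intro mult_right_mono power_le_one) auto
  also have "\<dots> < \<rho>\<^sub>0"
    using assms by simp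
  finally have r: "0 < \<tau> ^ m * \<rho>" "\<tau> ^ m * \<rho> < \<rho>\<^sub>0"
    using assms(1,5) by simp_all
  have "\<exists>W\<subseteq>E. finite W \<and> card W \<le> N \<and>
      E \<inter> ball z (\<tau> ^ m * \<rho>) \<subseteq> (\<Union>w\<in>W. ball w (\<tau> ^ Suc m * \<rho>))" if "z \<in> Z" for z
    using cover[OF _ r, of z] that Z(1) by (auto simp: mult.assoc)
  then obtain W where W: "\<And>z. z \<in> Z \<Longrightarrow> W z \<subseteq> E" "\<And>z. z \<in> Z \<Longrightarrow> finite (W z)"
    "\<And>z. z \<in> Z \<Longrightarrow> card (W z) \<le> N"
    "\<And>z. z \<in> Z \<Longrightarrow> E \<inter> ball z (\<tau> ^ m * \<rho>) \<subseteq> (\<Union>w\<in>W z. ball w (\<tau> ^ Suc m * \<rho>))"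
    by metis
  have "N \<ge> 0"
    using cover[OF assms(4-6)] by (meson of_nat_0_le_iff order_trans)
  have "real (card (\<Union>z\<in>Z. W z)) \<le> real (\<Sum>z\<in>Z. card (W z))"
    using card_UN_le[OF Z(2)] of_nat_le_iff by blast
  also have "\<dots> \<le> (\<Sum>z\<in>Z. N)"
    unfolding of_nat_sum by (rule sum_mono) (use W(3) in auto)
  also have "\<dots> \<le> N ^ Suc m"
    using mult_right_mono[OF Z(3) \<open>N \<ge> 0\<close>] by (simp add: mult.commute)
  finally have "real (card (\<Union>z\<in>Z. W z)) \<le> N ^ Suc m" .
  moreover have "E \<inter> ball y \<rho> \<subseteq> (\<Union>w\<in>(\<Union>z\<in>Z. W z). ball w (\<tau> ^ Suc m * \<rho>))"
  proof
    fix x assume "x \<in> E \<inter> ball y \<rho>"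
    then obtain z where "z \<in> Z" "x \<in> E \<inter> ball z (\<tau> ^ m * \<rho>)"
      using Z(4) by blast
    then show "x \<in> (\<Union>w\<in>(\<Union>z\<in>Z. W z). ball w (\<tau> ^ Suc m * \<rho>))"
      using W(4) by blast
  qed
  ultimately show ?case
    using Z(2) W(1,2) by (intro exI[of _ "\<Union>z\<in>Z. W z"]) auto
qed

text \<open>After \<open>m\<close> steps the total weight is at most a constant times \<open>(N * \<tau> powr t) ^ m\<close>: the
  condition \<open>N * \<tau> powr t < 1\<close> says that \<open>t\<close> exceeds the similarity dimension of the
  subdivision.\<close>

lemma self_similar_cover_imp_null:
  fixes E :: "'a::{metric_space, second_countable_topology} set" and N \<tau> t \<rho>\<^sub>0 :: real
  assumes "0 < \<tau>" "\<tau> < 1" "0 < t" "N * \<tau> powr t < 1" "0 < \<rho>\<^sub>0"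
    and cover: "\<And>y \<rho>. y \<in> E \<Longrightarrow> 0 < \<rho> \<Longrightarrow> \<rho> < \<rho>\<^sub>0 \<Longrightarrow>
      \<exists>Z\<subseteq>E. finite Z \<and> card Z \<le> N \<and> E \<inter> ball y \<rho> \<subseteq> (\<Union>z\<in>Z. ball z (\<tau> * \<rho>))"
  shows "hausdorff_measure t E = 0"
proof (cases "E = {}")
  case True
  then show ?thesis by (simp add: hausdorff_measure_empty)
next
  case False
  define \<rho> where "\<rho> = \<rho>\<^sub>0 / 2"
  have \<rho>: "0 < \<rho>" "\<rho> < \<rho>\<^sub>0"
    using \<open>0 < \<rho>\<^sub>0\<close> by (auto simp: \<rho>_def)
  have "N \<ge> 0"
    using False cover[OF _ \<rho>] by (meson all_not_in_conv of_nat_0_le_iff order_trans)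
  define q where "q = N * \<tau> powr t"
  define c where "c = unit_ball_vol t * \<rho> powr t"
  have "hausdorff_measure t (E \<inter> ball y \<rho>) = 0" if "y \<in> E" for y
    unfolding hausdorff_measure_eq_0_iff
  proof (intro allI impI)
    fix d :: real assume "d > 0"
    have "(\<lambda>m. 2 * (\<tau> ^ m * \<rho>)) \<longlonglongrightarrow> 2 * (0 * \<rho>)"
      using assms by (intro tendsto_intros LIMSEQ_realpow_zero) auto
    then have "eventually (\<lambda>m. 2 * (\<tau> ^ m * \<rho>) < d) sequentially"
      using \<open>d > 0\<close> by (intro order_tendstoD(2)) auto
    then have "eventually (\<lambda>m. hausdorff_premeasure d t (E \<inter> ball y \<rho>) \<le> ennreal (q ^ m * c))
        sequentially"
    proof eventually_elim
      case (elim m)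
      obtain Z where Z: "finite Z" "card Z \<le> N ^ m"
        "E \<inter> ball y \<rho> \<subseteq> (\<Union>z\<in>Z. ball z (\<tau> ^ m * \<rho>))"
        using iterate_ball_cover[OF assms(1,2) cover \<open>y \<in> E\<close> \<rho>, of m] by blast
      have "hausdorff_premeasure d t (E \<inter> ball y \<rho>)
          \<le> ennreal (card Z * (unit_ball_vol t * (\<tau> ^ m * \<rho>) powr t))"
        using elim assms(1,3) \<rho> Z by (intro hausdorff_premeasure_le_card) auto
      also have "\<dots> \<le> ennreal (N ^ m * (unit_ball_vol t * (\<tau> ^ m * \<rho>) powr t))"
        using Z(2) assms(3) by (intro ennreal_leI mult_right_mono) (auto intro: unit_ball_vol_nonneg)
      also have "(\<tau> ^ m * \<rho>) powr t = (\<tau> powr t) ^ m * \<rho> powr t"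
        using \<open>0 < \<tau>\<close> \<rho>
        by (simp add: powr_mult powr_power powr_realpow[symmetric] powr_powr mult.commute)
      also have "N ^ m * (unit_ball_vol t * ((\<tau> powr t) ^ m * \<rho> powr t)) = q ^ m * c"
        by (simp add: q_def c_def power_mult_distrib)
      finally show ?case .
    qed
    moreover have "(\<lambda>m. ennreal (q ^ m * c)) \<longlonglongrightarrow> ennreal (0 * c)"
      using assms \<open>N \<ge> 0\<close> unfolding q_def
      by (intro tendsto_ennrealI tendsto_intros LIMSEQ_realpow_zero) auto
    ultimately have "hausdorff_premeasure d t (E \<inter> ball y \<rho>) \<le> ennreal (0 * c)"
      by (intro tendsto_lowerbound) auto
    then show "hausdorff_premeasure d t (E \<inter> ball y \<rho>) = 0" by simp
  qed
  moreover obtain T where T: "countable T" "T \<subseteq> E" "E \<subseteq> closure T"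
    using separable[of E] by blast
  moreover have "T \<noteq> {}"
    using T False by auto
  ultimately have "hausdorff_measure t (\<Union>y\<in>T. E \<inter> ball y \<rho>) = 0"
    by (intro hausdorff_measure_UN_eq_0) auto
  moreover have "E \<subseteq> (\<Union>y\<in>T. E \<inter> ball y \<rho>)"
  proof
    fix x assume "x \<in> E"
    then obtain y where "y \<in> T" "dist y x < \<rho>"
      using T(3) \<rho>(1) closure_approachable[of x T] by blast
    then show "x \<in> (\<Union>y\<in>T. E \<inter> ball y \<rho>)"
      using \<open>x \<in> E\<close> by auto
  qed
  ultimately show ?thesis
    by (rule hausdorff_measure_subset_eq_0[rotated])
qed

section \<open>Covering a flat set\<close>

text \<open>Round the coordinates with respect to an orthonormal basis down to multiples of
  \<open>h = \<epsilon> / (k + 1)\<close>. Each of the \<open>k\<close> coordinates moves by at most \<open>h\<close>, so the point moves by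
  at most \<open>k * h \<le> \<epsilon>\<close>; and each rounded coordinate takes at most \<open>4 / h + 2 \<le> 6 / h\<close>
  values.\<close>

lemma subspace_ball_grid_net:
  fixes L :: "'a::euclidean_space set"
  assumes "subspace L" "dim L = k" "0 < \<epsilon>" "\<epsilon> \<le> 1"
  shows "\<exists>P. finite P \<and> card P \<le> (6 * (real k + 1) / \<epsilon>) ^ k \<and>
    (\<forall>x\<in>L. norm x \<le> 2 \<longrightarrow> (\<exists>p\<in>P. norm (x - p) \<le> \<epsilon>))"
proof -
  obtain B where B: "B \<subseteq> L" "pairwise orthogonal B" "\<And>b. b \<in> B \<Longrightarrow> norm b = 1"
    "independent B" "card B = k" "span B = L"
    using orthonormal_basis_subspace[OF assms(1)] assms(2) by blast
  have "finite B"
    using B(4) by (rule independent_imp_finite)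
  define h where "h = \<epsilon> / (real k + 1)"
  have h: "0 < h" "h \<le> 1" "k * h \<le> \<epsilon>"
    using assms(3,4) by (auto simp: h_def field_simps)
  define J where "J = {\<lfloor>- (2 / h)\<rfloor>..\<lfloor>2 / h\<rfloor>}"
  define P where "P = (\<lambda>g. \<Sum>b\<in>B. (h * of_int (g b)) *\<^sub>R b) ` (PiE B (\<lambda>_. J))"
  have fin: "finite (PiE B (\<lambda>_. J))"
    using \<open>finite B\<close> by (intro finite_PiE) (auto simp: J_def)
  have "\<lfloor>- (2 / h)\<rfloor> \<le> \<lfloor>2 / h\<rfloor>"
    using h(1) by (intro floor_mono) simp
  then have "real (card J) = of_int \<lfloor>2 / h\<rfloor> - of_int \<lfloor>- (2 / h)\<rfloor> + 1"
    by (simp add: J_def)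
  also have "\<dots> \<le> 2 * (2 / h) + 2"
    by linarith
  also have "\<dots> \<le> 6 / h"
    using h by (simp add: field_simps)
  finally have cJ: "real (card J) \<le> 6 * (real k + 1) / \<epsilon>"
    by (simp add: h_def)
  have "real (card P) \<le> real (card (PiE B (\<lambda>_. J)))"
    unfolding P_def by (simp add: card_image_le[OF fin])
  also have "\<dots> = real (card J) ^ k"
    using \<open>finite B\<close> B(5) by (simp add: card_PiE)
  also have "\<dots> \<le> (6 * (real k + 1) / \<epsilon>) ^ k"
    by (rule power_mono[OF cJ]) simp
  finally have "real (card P) \<le> (6 * (real k + 1) / \<epsilon>) ^ k" .
  moreover have "\<exists>p\<in>P. norm (x - p) \<le> \<epsilon>" if "x \<in> L" "norm x \<le> 2" for x
  proof -
    define g where "g = restrict (\<lambda>b. \<lfloor>(x \<bullet> b) / h\<rfloor>) B"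
    have "g b \<in> J" if "b \<in> B" for b
    proof -
      have "\<bar>x \<bullet> b\<bar> \<le> 2"
        using Cauchy_Schwarz_ineq2[of x b] B(3)[OF that] \<open>norm x \<le> 2\<close> by simp
      then have "- (2 / h) \<le> x \<bullet> b / h" "x \<bullet> b / h \<le> 2 / h"
        using h(1) by (simp_all add: field_simps abs_le_iff)
      then show ?thesis
        using that unfolding g_def J_def by (simp add: floor_mono)
    qed
    then have gP: "(\<Sum>b\<in>B. (h * of_int (g b)) *\<^sub>R b) \<in> P"
      unfolding P_def by (intro imageI) (auto simp: g_def PiE_iff extensional_def)
    have x: "x = (\<Sum>b\<in>B. (x \<bullet> b) *\<^sub>R b)"
    proof -
      define p where "p = (\<Sum>b\<in>B. (x \<bullet> b) *\<^sub>R b)"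
      have p: "p = (\<Sum>b\<in>B. (b \<bullet> x / (b \<bullet> b)) *\<^sub>R b)"
        unfolding p_def using B(3) by (intro sum.cong) (auto simp: dot_square_norm inner_commute)
      have "x - p \<in> span B"
        unfolding p_def using \<open>x \<in> L\<close> B(6)
        by (intro span_diff span_sum span_mul) (auto intro: span_base)
      then have "orthogonal (x - p) (x - p)"
        using Gram_Schmidt_step[OF B(2), of "x - p" x] unfolding p by blast
      then show ?thesis by (simp add: orthogonal_self p_def)
    qed
    have "norm (x - (\<Sum>b\<in>B. (h * of_int (g b)) *\<^sub>R b))
        = norm (\<Sum>b\<in>B. (x \<bullet> b - h * of_int (g b)) *\<^sub>R b)"
      by (subst x) (simp add: sum_subtractf scaleR_diff_left)
    also have "\<dots> \<le> (\<Sum>b\<in>B. h)"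
    proof (rule sum_norm_le)
      fix b assume "b \<in> B"
      have "h * of_int \<lfloor>x \<bullet> b / h\<rfloor> \<le> x \<bullet> b" "x \<bullet> b < h * of_int \<lfloor>x \<bullet> b / h\<rfloor> + h"
        using floor_divide_lower[OF h(1), of "x \<bullet> b"] floor_divide_upper[OF h(1), of "x \<bullet> b"]
        by (simp_all add: algebra_simps)
      then show "norm ((x \<bullet> b - h * of_int (g b)) *\<^sub>R b) \<le> h"
        using \<open>b \<in> B\<close> B(3) by (simp add: g_def)
    qed
    also have "\<dots> \<le> \<epsilon>"
      using B(5) h(3) by simp
    finally show ?thesis using gP by blast
  qed
  moreover have "finite P"
    unfolding P_def using fin by simp
  ultimately show ?thesis by blast
qed

text \<open>Cover the plane by a net; a set of points of \<open>E\<close> close to one net point lies in a ball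
  of twice the radius centred at any one of them, and this moves the centres from the net to \<open>E\<close>.
  The factor \<open>4\<close> arises as \<open>2 * (\<epsilon> + \<epsilon>)\<close>: distance to the plane plus distance to the net, then
  doubled by the change of centre.\<close>

lemma flat_at_scale_imp_cover:
  fixes E :: "'a::euclidean_space set"
  assumes "plane k L" "0 < \<epsilon>" "\<epsilon> \<le> 1" "0 < \<rho>"
    and flat: "blowup y \<rho> ` (E \<inter> ball y \<rho>) \<subseteq> L + ball 0 \<epsilon>"
  shows "\<exists>Z\<subseteq>E. finite Z \<and> card Z \<le> (6 * (real k + 1) / \<epsilon>) ^ k \<and>
    E \<inter> ball y \<rho> \<subseteq> (\<Union>z\<in>Z. ball z (4 * \<epsilon> * \<rho>))"
proof -
  obtain P where P: "finite P" "card P \<le> (6 * (real k + 1) / \<epsilon>) ^ k"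
    "\<And>x. x \<in> L \<Longrightarrow> norm x \<le> 2 \<Longrightarrow> \<exists>p\<in>P. norm (x - p) \<le> \<epsilon>"
    using subspace_ball_grid_net[of L k \<epsilon>] assms(1-3) unfolding plane_def by blast
  define F where "F p = {x \<in> E \<inter> ball y \<rho>. norm (blowup y \<rho> x - p) < 2 * \<epsilon>}" for p
  define Q where "Q = {p \<in> P. F p \<noteq> {}}"
  define f where "f p = (SOME x. x \<in> F p)" for p
  have f: "f p \<in> F p" if "p \<in> Q" for p
    using that unfolding Q_def f_def by (auto intro: someI)
  have "finite Q"
    using P(1) by (simp add: Q_def)
  have "card (f ` Q) \<le> card P"
    using card_image_le[OF \<open>finite Q\<close>, of f] card_mono[OF P(1), of Q] by (auto simp: Q_def)
  then have "real (card (f ` Q)) \<le> (6 * (real k + 1) / \<epsilon>) ^ k"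
    using P(2) by linarith
  moreover have "f ` Q \<subseteq> E"
    using f by (auto simp: F_def)
  moreover have "E \<inter> ball y \<rho> \<subseteq> (\<Union>z\<in>f ` Q. ball z (4 * \<epsilon> * \<rho>))"
  proof
    fix x assume x: "x \<in> E \<inter> ball y \<rho>"
    then obtain l e where le: "l \<in> L" "norm e < \<epsilon>" "blowup y \<rho> x = l + e"
      using flat by (force elim: set_plus_elim)
    have "norm (blowup y \<rho> x) < 1"
      using x \<open>0 < \<rho>\<close>
      by (simp add: blowup_def dist_norm norm_minus_commute) (simp add: field_simps)
    then have "norm l \<le> 2"
      using le norm_triangle_ineq4[of "l + e" e] assms(3) by simp
    then obtain p where p: "p \<in> P" "norm (l - p) \<le> \<epsilon>"
      using P(3) le(1) by blast
    have "norm (blowup y \<rho> x - p) < 2 * \<epsilon>"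
      using norm_triangle_ineq[of "l - p" e] le p by (simp add: algebra_simps)
    then have "x \<in> F p"
      using x by (simp add: F_def)
    then have "p \<in> Q"
      using p by (auto simp: Q_def)
    have "norm (blowup y \<rho> x - blowup y \<rho> (f p)) < 4 * \<epsilon>"
      using \<open>x \<in> F p\<close> f[OF \<open>p \<in> Q\<close>]
        norm_triangle_ineq4[of "blowup y \<rho> x - p" "blowup y \<rho> (f p) - p"]
      by (simp add: F_def)
    moreover have "blowup y \<rho> x - blowup y \<rho> (f p) = (x - f p) /\<^sub>R \<rho>"
      by (simp add: blowup_def flip: scaleR_diff_right)
    ultimately have "x \<in> ball (f p) (4 * \<epsilon> * \<rho>)"
      using \<open>0 < \<rho>\<close>
      by (simp add: dist_norm norm_minus_commute) (simp add: field_simps)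
    then show "x \<in> (\<Union>z\<in>f ` Q. ball z (4 * \<epsilon> * \<rho>))"
      using \<open>p \<in> Q\<close> by blast
  qed
  ultimately show ?thesis
    using \<open>finite Q\<close> by blast
qed

section \<open>Dimension of asymptotically flat sets\<close>

lemma asymptotically_flat_imp_null:
  fixes E :: "'a::euclidean_space set" and s :: real
  assumes "s > 0"
    and flat: "\<And>\<delta>::real. \<delta> > 0 \<Longrightarrow> \<exists>\<rho>\<^sub>0>0. \<forall>\<rho>\<in>{0<..<\<rho>\<^sub>0}. \<forall>y\<in>E. \<exists>L. plane k L \<and>
        blowup y \<rho> ` (E \<inter> ball y \<rho>) \<subseteq> L + ball 0 \<delta>"
  shows "hausdorff_measure (real k + s) E = 0"
proof -
  define A where "A = (24 * (real k + 1)) ^ k"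
  have "A > 0" by (simp add: A_def)
  \<comment> \<open>In terms of \<open>\<tau> = 4 * \<epsilon>\<close> the number of balls is \<open>A / \<tau> ^ k\<close>, so that one step has the
    factor \<open>A * \<tau> powr s\<close>; this \<open>\<tau>\<close> makes it at most \<open>1 / 2\<close>.\<close>
  define \<tau> where "\<tau> = min (1/2) ((1 / (2 * A)) powr (1 / s))"
  have \<tau>: "0 < \<tau>" "\<tau> < 1"
    using \<open>A > 0\<close> by (auto simp: \<tau>_def)
  have "\<tau> powr s \<le> ((1 / (2 * A)) powr (1 / s)) powr s"
    using \<tau> \<open>s > 0\<close> by (intro powr_mono2) (auto simp: \<tau>_def)
  also have "\<dots> = 1 / (2 * A)"
    using \<open>s > 0\<close> \<open>A > 0\<close> by (simp add: powr_powr)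
  finally have \<tau>s: "A * \<tau> powr s < 1"
    using \<open>A > 0\<close> by (simp add: field_simps)
  define \<epsilon> where "\<epsilon> = \<tau> / 4"
  have \<epsilon>: "0 < \<epsilon>" "\<epsilon> \<le> 1" "4 * \<epsilon> = \<tau>"
    using \<tau> by (auto simp: \<epsilon>_def)
  define N where "N = (6 * (real k + 1) / \<epsilon>) ^ k"
  have N: "N = A / \<tau> ^ k"
    by (simp add: N_def A_def \<epsilon>_def power_divide)
  obtain \<rho>\<^sub>0 where \<rho>\<^sub>0: "\<rho>\<^sub>0 > 0" "\<And>\<rho> y. 0 < \<rho> \<Longrightarrow> \<rho> < \<rho>\<^sub>0 \<Longrightarrow> y \<in> E \<Longrightarrow>
      \<exists>L. plane k L \<and> blowup y \<rho> ` (E \<inter> ball y \<rho>) \<subseteq> L + ball 0 \<epsilon>"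
    using flat[OF \<epsilon>(1)] by (metis greaterThanLessThan_iff)
  show ?thesis
  proof (rule self_similar_cover_imp_null[OF \<tau> _ _ \<rho>\<^sub>0(1)])
    show "0 < real k + s" using \<open>s > 0\<close> by simp
    show "N * \<tau> powr (real k + s) < 1"
      using \<tau> \<tau>s by (simp add: N powr_add powr_realpow)
  next
    fix y \<rho> assume "y \<in> E" "0 < \<rho>" "\<rho> < \<rho>\<^sub>0"
    then obtain L where "plane k L" "blowup y \<rho> ` (E \<inter> ball y \<rho>) \<subseteq> L + ball 0 \<epsilon>"
      using \<rho>\<^sub>0(2) by blast
    then show "\<exists>Z\<subseteq>E. finite Z \<and> card Z \<le> N \<and> E \<inter> ball y \<rho> \<subseteq> (\<Union>z\<in>Z. ball z (\<tau> * \<rho>))"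
      using flat_at_scale_imp_cover[OF _ \<epsilon>(1,2) \<open>0 < \<rho>\<close>] unfolding N_def \<epsilon>(3) by simp
  qed
qed

theorem lemma25:
  fixes k :: nat and E :: "(real ^ 'n) set"
  assumes "k \<le> CARD('n)"
    and "\<And>\<delta>::real. \<delta> > 0 \<Longrightarrow>
      \<exists>\<rho>\<^sub>0>0. \<forall>\<rho>\<in>{0<..<\<rho>\<^sub>0}. \<forall>y\<in>E. \<exists>L. plane k L \<and>
        blowup y \<rho> ` (E \<inter> ball y \<rho>) \<subseteq> L + ball 0 \<delta>"
  shows "\<exists>\<omega>. modulus_of_continuity \<omega> \<and>
    (\<forall>\<delta>>0. hausdorff_measure (real k + \<omega> \<delta>) E = 0)"
proof (intro exI[of _ "\<lambda>\<delta>. \<delta>"] conjI)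
  show "modulus_of_continuity (\<lambda>\<delta>. \<delta>)"
    by (auto simp: modulus_of_continuity_def intro: mono_onI)
  show "\<forall>\<delta>>0. hausdorff_measure (real k + \<delta>) E = 0"
    using asymptotically_flat_imp_null[OF _ assms(2)] by blast
qed

end
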